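(* Let $f_1,\dots,f_k\in\mathbb{F}_{q^m}\langle X^q\rangle$ ($k\ge2$) be nonzero linearized polynomials. For $i\in\{1,\dots,k\}$ let $b_i$ be the least left common multiple of the $f_j$ with $j\ne i$, assume $f_i\wedge_r b_i=X$, and let $S_{1,i},S_{2,i}\in\mathbb{F}_{q^m}\langle X^q\rangle$ satisfy $S_{1,i}\circ b_i+S_{2,i}\circ f_i=X$. For $g\in\mathbb{F}_{q^m}\langle X^q\rangle$ put $$G=\sum_{i=1}^{k}\pi_i(g)\circ S_{1,i}\circ b_i .$$ Then $g-G\in(f_1\vee_l\cdots\vee_l f_k)_l$, and if $\deg_q(g)<\deg_q(f_1\vee_l\cdots\vee_l f_k)$ then $\pi_{1,k}(G)=g$.
   Context: Let $q$ be a prime power and $m\ge1$. $\mathbb{F}_{q^m}\langle X^q\rangle$ is the set of linearized polynomials $\sum_{i=0}^d p_iX^{q^i}$, $p_i\in\mathbb{F}_{q^m}$, a non-commutative ring under addition and composition $\circ$, determined by $(aX^{q^i})\circ(bX^{q^j})=ab^{q^i}X^{q^{i+j}}$; its unit element is $X$. The $q$-degree $\deg_q(P)$ of a nonzero $P$ is the largest $i$ such that the coefficient of $X^{q^i}$ is nonzero (and $\deg_q(0)=-\infty$). For $B\neq0$, right division of $A$ by $B$ is the unique writing $A=Q\circ B+R$ with $\deg_q R<\deg_q B$; $R$ is the remainder. $(P)_l$ is the left ideal $\{Q\circ P\}$. $A\wedge_r B$ denotes the greatest right common divisor (up to a nonzero scalar), $A\vee_l B$ the least left common multiple (a generator of $(A)_l\cap(B)_l$).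 $\pi_i(g)$ denotes the remainder of the right division of $g$ by $f_i$, and $\pi_{1,k}(g)$ the remainder of the right division of $g$ by $f_1\vee_l\cdots\vee_l f_k$. *)

theory Defs
  imports
    "HOL-Computational_Algebra.Polynomial"
    "HOL-Number_Theory.Prime_Powers"
    "HOL-Library.Cardinality"
    "HOL-Library.Extended_Real"
begin

(* Linearized polynomials are ordinary polynomials supported on the exponents q^i; their
   product is the library's composition of polynomials and the unit is X = [:0, 1:]. *)
definition linearized :: "nat \<Rightarrow> 'a::field poly set" where
  "linearized q = {P. \<forall>n. coeff P n \<noteq> 0 \<longrightarrow> (\<exists>i. n = q ^ i)}"

(* Extended reals are used only to have the value -\<infinity> for the zero polynomial. *)
definition qdeg :: "nat \<Rightarrow> 'a::field poly \<Rightarrow> ereal" where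
  "qdeg q P = (if P = 0 then -\<infinity> else ereal (real (Max {i. coeff P (q ^ i) \<noteq> 0})))"

(* The description is proper for B \<noteq> 0, by existence and uniqueness of right division. *)
definition right_rem :: "nat \<Rightarrow> 'a::field poly \<Rightarrow> 'a poly \<Rightarrow> 'a poly" where
  "right_rem q A B = (THE R. R \<in> linearized q \<and> qdeg q R < qdeg q B \<and>
     (\<exists>Q \<in> linearized q. A = Q \<circ>\<^sub>p B + R))"

definition left_ideal :: "nat \<Rightarrow> 'a::field poly \<Rightarrow> 'a poly set" where
  "left_ideal q P = {Q \<circ>\<^sub>p P | Q. Q \<in> linearized q}"

definition right_divides :: "nat \<Rightarrow> 'a::field poly \<Rightarrow> 'a poly \<Rightarrow> bool" where
  "right_divides q D A \<longleftrightarrow> (\<exists>Q \<in> linearized q. A = Q \<circ>\<^sub>p D)"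

(* Greatest right common divisors and least left common multiples are determined only up to
   a nonzero scalar factor, hence relations. *)
definition is_gcrd :: "nat \<Rightarrow> 'a::field poly \<Rightarrow> 'a poly \<Rightarrow> 'a poly \<Rightarrow> bool" where
  "is_gcrd q A B D \<longleftrightarrow> D \<in> linearized q \<and> right_divides q D A \<and> right_divides q D B \<and>
     (\<forall>E \<in> linearized q. right_divides q E A \<and> right_divides q E B \<longrightarrow> right_divides q E D)"

(* L is a least left common multiple of the family (f j) for j in J; since each left_ideal is
   the ideal of its generator, iterating the binary operation gives the same generators. *)
definition is_llcm :: "nat \<Rightarrow> (nat \<Rightarrow> 'a::field poly) \<Rightarrow> nat set \<Rightarrow> 'a poly \<Rightarrow> bool" where
  "is_llcm q f J L \<longleftrightarrow> L \<in> linearized q \<and> left_ideal q L = (\<Inter>j\<in>J. left_ideal q (f j))"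

end

theory Submission
  imports Defs
begin

text \<open>Modulo \<open>f j\<close> only the summand with index \<open>j\<close> of \<open>G\<close> survives, because \<open>b i\<close> is a left multiple
  of \<open>f j\<close> for \<open>i \<noteq> j\<close>. By Bezout that summand equals \<open>\<pi>\<^sub>j(g) \<circ> (X - S2 j \<circ> f j)\<close>, which is
  congruent to \<open>\<pi>\<^sub>j(g)\<close> and hence to \<open>g\<close>. So \<open>g - G\<close> lies in every \<open>left_ideal q (f j)\<close>, and the
  second claim is uniqueness of the remainder. Composition is additive on the left always, and on
  the right because \<open>q\<close> is a power of the characteristic.\<close>

text \<open>Isolates the arithmetic that makes \<open>q\<close>-th powers additive. The parameter
  \<open>ty\<close> serves to fix the type \<open>'a\<close> whose characteristic is meant; the
  positive exponent ensures that \<open>q ^ i\<close> determines \<open>i\<close>.\<close>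

locale frobenius_exponent =
  fixes q :: nat and ty :: "'a::field itself"
  assumes prime_CHAR: "prime CHAR('a)"
    and q_power_CHAR: "\<exists>n>0. q = CHAR('a) ^ n"
begin

section \<open>Linearized polynomials under addition and composition\<close>

lemma q_gt_1: "q > 1"
  using q_power_CHAR prime_gt_1_nat[OF prime_CHAR] by (metis one_less_power)

text \<open>The polynomial ring inherits the characteristic of its coefficient field, so
  \<open>q ^ i\<close> is a power of that prime and the Frobenius identity applies.\<close>

lemma add_power_q: "(A + B) ^ (q ^ i) = A ^ (q ^ i) + B ^ (q ^ i)" for A B :: "'a poly"
proof -
  obtain n where "q = CHAR('a) ^ n" using q_power_CHAR by blast
  then have "q ^ i = CHAR('a poly) ^ (n * i)" by (simp add: power_mult)
  then show ?thesis using prime_CHAR by (intro freshmans_dream'[where n = "n * i"]) auto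
qed

lemma linearized_0 [simp]: "(0 :: 'a poly) \<in> linearized q"
  by (simp add: linearized_def)

lemma linearized_monom [simp]: "monom c (q ^ i) \<in> linearized q" for c :: 'a
  by (auto simp: linearized_def coeff_monom)

lemma linearized_X [simp]: "[:0, 1 :: 'a:] \<in> linearized q"
  using linearized_monom[of 1 0] by (simp add: monom_altdef)

lemma linearized_add: "A \<in> linearized q \<Longrightarrow> B \<in> linearized q \<Longrightarrow> A + B \<in> linearized q"
  for A B :: "'a poly"
  unfolding linearized_def by (auto, metis add.left_neutral)

lemma linearized_uminus: "A \<in> linearized q \<Longrightarrow> - A \<in> linearized q"
  for A :: "'a poly"
  by (auto simp: linearized_def)

lemma linearized_diff: "A \<in> linearized q \<Longrightarrow> B \<in> linearized q \<Longrightarrow> A - B \<in> linearized q"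
  for A B :: "'a poly"
  using linearized_add[of A "- B"] linearized_uminus[of B] by simp

lemma linearized_smult: "A \<in> linearized q \<Longrightarrow> smult c A \<in> linearized q"
  for A :: "'a poly"
  by (auto simp: linearized_def)

text \<open>A polynomial is the sum of its monomials, and for a linearized one each of them is zero
  or has a power of \<open>q\<close> as exponent. Claims about composition thus reduce to single
  monomials.\<close>

lemma linearized_induct [consumes 1, case_names zero monom add]:
  fixes A :: "'a poly"
  assumes "A \<in> linearized q"
    and zero: "P 0"
    and monom: "\<And>c i. P (monom c (q ^ i))"
    and add: "\<And>A B. P A \<Longrightarrow> P B \<Longrightarrow> P (A + B)"
  shows "P A"
proof -
  have *: "P (monom (coeff A n) n)" for n
    using assms(1) zero monom by (cases "coeff A n = 0") (auto simp: linearized_def)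
  have "P (\<Sum>n\<in>N. monom (coeff A n) n)" if "finite N" for N
    using that by (induction N rule: finite_induct) (auto intro: zero add *)
  from this[of "{..degree A}"] show ?thesis by (simp add: poly_as_sum_of_monoms)
qed

lemma pcompose_monom: "monom c n \<circ>\<^sub>p B = smult c (B ^ n)" for B :: "'a poly"
  by (induction n)
    (simp_all add: monom_altdef pcompose_smult pcompose_mult pcompose_pCons pcompose_1)

lemma linearized_power: "A \<in> linearized q \<Longrightarrow> A ^ (q ^ i) \<in> linearized q"
  for A :: "'a poly"
proof (induction A rule: linearized_induct)
  case zero
  then show ?case using q_gt_1 by (simp add: power_0_left)
next
  case (monom c j)
  then show ?case by (simp add: monom_power flip: power_add)
next
  case (add A B)
  then show ?case by (simp add: add_power_q linearized_add)
qed

lemma linearized_pcompose: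
  fixes A B :: "'a poly"
  assumes "A \<in> linearized q" "B \<in> linearized q"
  shows "A \<circ>\<^sub>p B \<in> linearized q"
  using assms(1)
proof (induction A rule: linearized_induct)
  case (monom c i)
  then show ?case using assms(2) by (simp add: pcompose_monom linearized_smult linearized_power)
qed (simp_all add: pcompose_add linearized_add)

text \<open>Composing a monomial with \<open>B\<close> raises \<open>B\<close> to a power
  \<open>q ^ i\<close>, which is additive in \<open>B\<close>.\<close>

lemma pcompose_add_right:
  fixes A B C :: "'a poly"
  assumes "A \<in> linearized q"
  shows "A \<circ>\<^sub>p (B + C) = A \<circ>\<^sub>p B + A \<circ>\<^sub>p C"
  using assms
  by (induction A rule: linearized_induct)
    (simp_all add: pcompose_monom add_power_q smult_add_right pcompose_add)

section \<open>Degrees and right division\<close>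

lemma degree_linearized:
  fixes A :: "'a poly"
  assumes "A \<in> linearized q" "A \<noteq> 0"
  obtains i where "degree A = q ^ i"
proof -
  have "lead_coeff A \<noteq> 0" using assms(2) by simp
  then obtain i where "degree A = q ^ i" using assms(1) unfolding linearized_def by blast
  then show ?thesis by (rule that)
qed

text \<open>No power of \<open>q\<close> equals 0, so nonzero constants are not linearized.\<close>

lemma degree_eq_0_linearized:
  fixes A :: "'a poly"
  assumes "A \<in> linearized q"
  shows "degree A = 0 \<longleftrightarrow> A = 0"
proof (cases "A = 0")
  case False
  then obtain i where "degree A = q ^ i" using degree_linearized assms by blast
  then show ?thesis using False q_gt_1 by simp
qed simp

lemma qdeg_eq:
  fixes A :: "'a poly"
  assumes "A \<noteq> 0" "degree A = q ^ i"
  shows "qdeg q A = ereal (real i)"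
proof -
  have *: "j \<le> i" if "coeff A (q ^ j) \<noteq> 0" for j
    using le_degree[OF that] assms(2) q_gt_1 by simp
  have "Max {i. coeff A (q ^ i) \<noteq> 0} = i"
  proof (rule Max_eqI)
    show "finite {i. coeff A (q ^ i) \<noteq> 0}"
      by (rule finite_subset[of _ "{..i}"]) (use * in auto)
    have "coeff A (q ^ i) \<noteq> 0"
      using assms(1) by (simp flip: assms(2))
    then show "i \<in> {i. coeff A (q ^ i) \<noteq> 0}" by simp
  qed (use * in simp)
  then show ?thesis using assms(1) by (simp add: qdeg_def)
qed

text \<open>Powers of \<open>q\<close> increase strictly with the exponent, and the value
  -\<infinity> at 0 corresponds to degree 0, which lies below the degree of any nonzero linearized
  polynomial. Ordinary degrees can therefore replace \<open>qdeg\<close>.\<close>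

lemma qdeg_less_iff:
  fixes A B :: "'a poly"
  assumes "A \<in> linearized q" "B \<in> linearized q"
  shows "qdeg q A < qdeg q B \<longleftrightarrow> degree A < degree B"
proof (cases "B = 0")
  case True
  then show ?thesis by (simp add: qdeg_def)
next
  case False
  then obtain j where j: "degree B = q ^ j" using degree_linearized assms by blast
  show ?thesis
  proof (cases "A = 0")
    case True
    then show ?thesis
      using False degree_eq_0_linearized[OF assms(2)] by (simp add: qdeg_def)
  next
    case A: False
    then obtain i where "degree A = q ^ i" using degree_linearized assms by blast
    then show ?thesis using A False j q_gt_1 by (simp add: qdeg_eq)
  qed
qed

text \<open>Euclidean division by induction on the degree: a left multiple of \<open>B\<close> by a
  monomial cancels the leading term of \<open>A\<close>.\<close>

lemma right_division_exists:
  fixes A B :: "'a poly"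
  assumes "A \<in> linearized q" "B \<in> linearized q" "B \<noteq> 0"
  shows "\<exists>Q\<in>linearized q. \<exists>R\<in>linearized q. A = Q \<circ>\<^sub>p B + R \<and> degree R < degree B"
  using assms(1)
proof (induction "degree A" arbitrary: A rule: less_induct)
  case less
  show ?case
  proof (cases "degree A < degree B")
    case True
    then show ?thesis using less.prems by (intro bexI[of _ 0] bexI[of _ A]) auto
  next
    case False
    obtain j where j: "degree B = q ^ j" using degree_linearized assms by blast
    have A: "A \<noteq> 0" using False j q_gt_1 by auto
    then obtain i where i: "degree A = q ^ i" using degree_linearized less.prems by blast
    have "j \<le> i" using False i j q_gt_1 by simp
    \<comment> \<open>\<open>M \<circ>\<^sub>p B\<close> has degree
      \<open>N * q ^ j = q ^ i\<close>, and its leading coefficient is that of \<open>M\<close>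
      times \<open>lead_coeff B ^ N\<close>; this dictates both choices.\<close>
    define N where "N = q ^ (i - j)"
    define M where "M = monom (lead_coeff A / lead_coeff B ^ N) N"
    have M: "M \<in> linearized q" by (simp add: M_def N_def)
    have MB: "M \<circ>\<^sub>p B \<in> linearized q" using M assms(2) by (rule linearized_pcompose)
    have "degree M = N" using A assms(3) by (simp add: M_def degree_monom_eq)
    then have deg: "degree (M \<circ>\<^sub>p B) = degree A"
      using \<open>j \<le> i\<close> i j by (simp add: degree_pcompose N_def flip: power_add)
    have "lead_coeff (M \<circ>\<^sub>p B) = lead_coeff A"
      using assms(3) by (simp add: M_def pcompose_monom lead_coeff_power)
    then have "coeff (A - M \<circ>\<^sub>p B) (degree A) = 0" using deg by simp
    moreover have "degree (A - M \<circ>\<^sub>p B) \<le> degree A" using deg by (intro degree_diff_le) auto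
    \<comment> \<open>Excludes the case that the difference is 0 while \<open>degree A\<close> is 0,
      where the degree would not drop.\<close>
    moreover have "degree A > 0" using i q_gt_1 by simp
    ultimately have "degree (A - M \<circ>\<^sub>p B) < degree A"
      by (metis degree_0 leading_coeff_0_iff nat_less_le)
    from less.hyps[OF this linearized_diff[OF less.prems MB]]
    obtain Q R where QR: "Q \<in> linearized q" "R \<in> linearized q"
      "A - M \<circ>\<^sub>p B = Q \<circ>\<^sub>p B + R" "degree R < degree B" by blast
    then have "A = (Q + M) \<circ>\<^sub>p B + R" by (simp add: pcompose_add algebra_simps)
    then show ?thesis using QR M linearized_add by blast
  qed
qed

text \<open>Degrees multiply under composition. Two remainders differ by
  \<open>(Q - Q') \<circ>\<^sub>p B\<close> of degree below that of \<open>B\<close>, so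
  \<open>Q - Q'\<close> has degree 0 and, being linearized, vanishes.\<close>

lemma right_rem_eqI:
  fixes A B Q R :: "'a poly"
  assumes "B \<in> linearized q" "Q \<in> linearized q" "R \<in> linearized q"
    and "degree R < degree B" "A = Q \<circ>\<^sub>p B + R"
  shows "right_rem q A B = R"
  unfolding right_rem_def
proof (rule the_equality)
  show "R \<in> linearized q \<and> qdeg q R < qdeg q B \<and> (\<exists>Q\<in>linearized q. A = Q \<circ>\<^sub>p B + R)"
    using assms by (auto simp: qdeg_less_iff)
next
  fix R' assume R': "R' \<in> linearized q \<and> qdeg q R' < qdeg q B \<and> (\<exists>Q\<in>linearized q. A = Q \<circ>\<^sub>p B + R')"
  then obtain Q' where Q': "Q' \<in> linearized q" "A = Q' \<circ>\<^sub>p B + R'" by blast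
  have "degree R' < degree B" using R' qdeg_less_iff[OF _ assms(1)] by blast
  then have "degree (R' - R) < degree B" using assms(4) by (rule degree_diff_less)
  moreover have eq: "R' - R = (Q - Q') \<circ>\<^sub>p B"
    using Q' assms(5) by (simp add: pcompose_diff algebra_simps)
  ultimately have "degree (Q - Q') = 0" by (simp add: degree_pcompose)
  then have "Q - Q' = 0"
    using degree_eq_0_linearized linearized_diff[OF assms(2) Q'(1)] by blast
  then show "R' = R" using eq by simp
qed

lemma right_rem_cong:
  fixes A B :: "'a poly"
  assumes "A \<in> linearized q" "B \<in> linearized q" "B \<noteq> 0"
  shows "right_rem q A B \<in> linearized q" "A - right_rem q A B \<in> left_ideal q B"
proof -
  obtain Q R where "Q \<in> linearized q" "R \<in> linearized q"
    "A = Q \<circ>\<^sub>p B + R" "degree R < degree B"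
    using right_division_exists[OF assms] by blast
  moreover from this have "right_rem q A B = R" using assms(2) by (intro right_rem_eqI)
  ultimately show "right_rem q A B \<in> linearized q" "A - right_rem q A B \<in> left_ideal q B"
    by (auto simp: left_ideal_def)
qed

section \<open>Closure properties of left ideals\<close>

lemma left_ideal_self: "B \<in> left_ideal q B" for B :: "'a poly"
proof -
  have "B = [:0, 1:] \<circ>\<^sub>p B" by (simp add: pcompose_pCons)
  then show ?thesis unfolding left_ideal_def using linearized_X by blast
qed

lemma left_ideal_add:
  fixes A B C :: "'a poly"
  assumes "A \<in> left_ideal q C" "B \<in> left_ideal q C"
  shows "A + B \<in> left_ideal q C"
  using assms unfolding left_ideal_def by (auto simp flip: pcompose_add intro: linearized_add)

lemma left_ideal_diff:
  fixes A B C :: "'a poly"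
  assumes "A \<in> left_ideal q C" "B \<in> left_ideal q C"
  shows "A - B \<in> left_ideal q C"
  using assms unfolding left_ideal_def by (auto simp flip: pcompose_diff intro: linearized_diff)

lemma left_ideal_pcompose:
  fixes A B C :: "'a poly"
  assumes "A \<in> linearized q" "B \<in> left_ideal q C"
  shows "A \<circ>\<^sub>p B \<in> left_ideal q C"
  using assms unfolding left_ideal_def by (auto simp: pcompose_assoc intro: linearized_pcompose)

lemma left_ideal_sum:
  fixes h :: "'b \<Rightarrow> 'a poly"
  assumes "\<And>i. i \<in> I \<Longrightarrow> h i \<in> left_ideal q C"
  shows "(\<Sum>i\<in>I. h i) \<in> left_ideal q C"
proof -
  \<comment> \<open>Covers the empty sum and the default value 0 of a sum over an infinite
    set.\<close>
  have "(0 :: 'a poly) = 0 \<circ>\<^sub>p C" by simp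
  then have "0 \<in> left_ideal q C" unfolding left_ideal_def using linearized_0 by blast
  then show ?thesis using assms by (induction I rule: infinite_finite_induct) (auto intro: left_ideal_add)
qed

end

text \<open>The characteristic divides the cardinality of the field, a power of the prime
  \<open>r\<close> underlying \<open>q\<close>, and hence equals \<open>r\<close>.\<close>

lemma frobenius_exponent_finite_field:
  assumes "primepow q" "CARD('a::{field,finite}) = q ^ m"
  shows "frobenius_exponent TYPE('a) q"
proof
  have "CHAR('a) > 0" by (rule finite_imp_CHAR_pos) simp
  then show p: "prime CHAR('a)" using prime_CHAR_semidom by blast
  obtain r n where r: "prime r" "n > 0" "q = r ^ n"
    using assms(1) by (auto simp: primepow_def)
  \<comment> \<open>Translation by 1 permutes the field, so the sum of all elements is unchanged
    when the cardinality is added to it.\<close>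
  have "(\<Sum>x\<in>UNIV. x :: 'a) = (\<Sum>x\<in>UNIV. x + 1)"
    by (rule sum.reindex_bij_witness[of _ "\<lambda>x. x + 1" "\<lambda>x. x - 1"]) auto
  then have "of_nat CARD('a) = (0 :: 'a)" by (simp add: sum.distrib)
  then have "CHAR('a) dvd CARD('a)" by (simp only: of_nat_eq_0_iff_char_dvd)
  then have "CHAR('a) dvd r ^ (n * m)"
    by (simp only: assms(2) r(3) power_mult)
  then have "CHAR('a) = r"
    using p r prime_dvd_power primes_dvd_imp_eq by blast
  then show "\<exists>n>0. q = CHAR('a) ^ n" using r by blast
qed

section \<open>Chinese remainder reconstruction\<close>

theorem theorem13:
  fixes q m k :: nat
    and f b S1 S2 :: "nat \<Rightarrow> 'a::{field,finite} poly"
    and L g G :: "'a poly"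
  assumes "primepow q" and "m \<ge> 1" and "CARD('a) = q ^ m" and "k \<ge> 2"
    and "\<And>i. i \<in> {1..k} \<Longrightarrow> f i \<in> linearized q \<and> f i \<noteq> 0"
    and "is_llcm q f {1..k} L"
    and "\<And>i. i \<in> {1..k} \<Longrightarrow> is_llcm q f ({1..k} - {i}) (b i)"
    and "\<And>i. i \<in> {1..k} \<Longrightarrow> is_gcrd q (f i) (b i) [:0, 1:]"
    and "\<And>i. i \<in> {1..k} \<Longrightarrow> S1 i \<in> linearized q \<and> S2 i \<in> linearized q"
    and "\<And>i. i \<in> {1..k} \<Longrightarrow> S1 i \<circ>\<^sub>p b i + S2 i \<circ>\<^sub>p f i = [:0, 1:]"
    and "g \<in> linearized q"
    and "G = (\<Sum>i=1..k. right_rem q g (f i) \<circ>\<^sub>p S1 i \<circ>\<^sub>p b i)"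
  shows "g - G \<in> left_ideal q L \<and> (qdeg q g < qdeg q L \<longrightarrow> right_rem q G L = g)"
proof -
  interpret frobenius_exponent q "TYPE('a)"
    using assms(1,3) by (rule frobenius_exponent_finite_field)
  define h where "h i = right_rem q g (f i) \<circ>\<^sub>p S1 i \<circ>\<^sub>p b i" for i
  have G: "G = (\<Sum>i=1..k. h i)" using assms(12) by (simp add: h_def)
  have rem: "right_rem q g (f i) \<in> linearized q" "g - right_rem q g (f i) \<in> left_ideal q (f i)"
    if "i \<in> {1..k}" for i
    using right_rem_cong assms(5,11) that by auto
  have other: "h i \<in> left_ideal q (f j)" if "i \<in> {1..k}" "j \<in> {1..k}" "i \<noteq> j" for i j
  proof -
    \<comment> \<open>\<open>b i\<close> generates the intersection of the left ideals of all
      \<open>f l\<close> with \<open>l \<noteq> i\<close>, and \<open>j\<close> is such an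
      index.\<close>
    have "b i \<in> left_ideal q (f j)"
      using assms(7)[OF that(1)] that left_ideal_self[of "b i"] unfolding is_llcm_def by blast
    then show ?thesis unfolding h_def
      using that assms(9) rem by (intro left_ideal_pcompose linearized_pcompose) auto
  qed
  have own: "g - h j \<in> left_ideal q (f j)" if j: "j \<in> {1..k}" for j
  proof -
    let ?r = "right_rem q g (f j)"
    \<comment> \<open>The unit X is inserted on the right in its Bezout form; distributing over it
      requires \<open>?r\<close> to be linearized.\<close>
    have "?r = ?r \<circ>\<^sub>p (S1 j \<circ>\<^sub>p b j + S2 j \<circ>\<^sub>p f j)"
      using assms(10)[OF j] by simp
    also have "\<dots> = h j + ?r \<circ>\<^sub>p (S2 j \<circ>\<^sub>p f j)"
      using rem(1)[OF j] by (simp add: pcompose_add_right h_def pcompose_assoc)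
    finally have "g - h j = (g - ?r) + ?r \<circ>\<^sub>p (S2 j \<circ>\<^sub>p f j)"
      by (simp add: algebra_simps)
    also have "\<dots> \<in> left_ideal q (f j)"
      using rem[OF j] assms(9)[OF j]
      by (intro left_ideal_add left_ideal_pcompose left_ideal_self) auto
    finally show ?thesis .
  qed
  have "g - G \<in> left_ideal q (f j)" if j: "j \<in> {1..k}" for j
  proof -
    \<comment> \<open>Splits off the one summand not in the ideal by \<open>other\<close>;
      \<open>own\<close> handles it together with \<open>g\<close>.\<close>
    have "g - G = (g - h j) - (\<Sum>i\<in>{1..k} - {j}. h i)"
      using j by (simp add: G sum.remove[of _ j] algebra_simps)
    also have "\<dots> \<in> left_ideal q (f j)"
      using other j by (intro left_ideal_diff[OF own[OF j]] left_ideal_sum) auto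
    finally show ?thesis .
  qed
  then have mem: "g - G \<in> left_ideal q L" using assms(6) unfolding is_llcm_def by blast
  moreover have "right_rem q G L = g" if "qdeg q g < qdeg q L"
  proof -
    have L: "L \<in> linearized q" using assms(6) by (simp add: is_llcm_def)
    obtain Q where Q: "Q \<in> linearized q" "g - G = Q \<circ>\<^sub>p L"
      using mem unfolding left_ideal_def by blast
    \<comment> \<open>By the degree bound on \<open>g\<close>, this is already a right division of
      \<open>G\<close> by \<open>L\<close>, with remainder \<open>g\<close>.\<close>
    then have "G = (- Q) \<circ>\<^sub>p L + g" by (simp add: pcompose_uminus algebra_simps)
    then show ?thesis
      using L Q(1) assms(11) that
      by (intro right_rem_eqI[where Q = "- Q"]) (simp_all add: linearized_uminus qdeg_less_iff)
  qed
  ultimately show ?thesis by blast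
qed

end
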